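(* Let $\kappa$ be a field and $G$ an infinite group having a non-trivial element of finite order. Suppose that $T\subseteq G\times G$ satisfies $(1,1)\notin T$ and $(y^{-1},x^{-1})\in T$ whenever $(x,y)\in T$, and let $\sigma=\sigma_T$ be the idempotent factor set generated by $T$. If $|T|<|G|$, then the spectral partial action $\hat\theta$ of $G$ on $\Omega_{\sigma}$ is topologically free.
   Context: For $a,b\in G$, $C_{(a,b)}:=\{(a,b),(b^{-1}a^{-1},a),(b,b^{-1}a^{-1}),(b^{-1},a^{-1}),(a^{-1},ab),(ab,b^{-1})\}$. For $T$ as in the claim put $T_1=\{(x,y)\in T:x\neq1,\ y\neq1,\ x\neq y^{-1}\}$ and $T_0=\{x\in G\setminus\{1\}:C_{(x,x^{-1})}\cap T\neq\varnothing\}$. Define $\sigma^0(x,y)=0$ if $\{x,y,xy\}\cap T_0\neq\varnothing$ and $\sigma^0(x,y)=1$ otherwise; define $\sigma^1(x,y)=0$ if $C_{(x,y)}\cap T_1\neq\varnothing$ and $\sigma^1(x,y)=1$ otherwise. The idempotent factor set generated by $T$ is the pointwise product $\sigma_T:=\sigma^0\sigma^1:G\times G\to\kappa$. For a factor set $\sigma:G\times G\to\kappa$: let $\Omega=\{\xi\subseteq G:1\in\xi\}$, identified with $\prod_{g\in G\setminus\{1\}}\{0,1\}$ and given the product topology. The $\sigma$-prohibitions of type I are the sets $\{h,hg,hgs\}$ with $h,g,s\in G$ and $\sigma(g,s)=0$; those of type II are the sets $\{h,hg,hgs,hgst\}$ with $h,g,s,t\in G$ and $\sigma(g,st)\sigma(s,t)\neq\sigma(g,s)\sigma(gs,t)$.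 $\mathcal{P}_\sigma$ is the set of all $\sigma$-prohibitions (of both types), and $\Omega_\sigma=\{\xi\in\Omega: V\nsubseteq\xi\text{ for all }V\in\mathcal{P}_\sigma\}$ with the subspace topology. The spectral partial action $\hat\theta$ of $G$ on $\Omega_\sigma$ is given by the clopen sets $\hat D_g=\{\xi\in\Omega_\sigma:g\in\xi\}$ and the homeomorphisms $\hat\theta_g:\hat D_{g^{-1}}\to\hat D_g$, $\hat\theta_g(\xi)=g\xi$. A topological partial action $(\{X_g\},\{\theta_g:X_{g^{-1}}\to X_g\})$ of $G$ on a space $X$ is topologically free if for every $g\neq1_G$ the set $\{x\in X_{g^{-1}}:\theta_g(x)=x\}$ has empty interior. *)

theory Defs
  imports "HOL-Algebra.Coset" "HOL-Algebra.Ring" "HOL-Analysis.Function_Topology" "HOL-Library.Equipollence"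
begin

definition orbit_C :: "('a, 'm) monoid_scheme \<Rightarrow> 'a \<times> 'a \<Rightarrow> ('a \<times> 'a) set" where
  "orbit_C G = (\<lambda>(a, b).
     {(a, b),
      (inv\<^bsub>G\<^esub> b \<otimes>\<^bsub>G\<^esub> inv\<^bsub>G\<^esub> a, a),
      (b, inv\<^bsub>G\<^esub> b \<otimes>\<^bsub>G\<^esub> inv\<^bsub>G\<^esub> a),
      (inv\<^bsub>G\<^esub> b, inv\<^bsub>G\<^esub> a),
      (inv\<^bsub>G\<^esub> a, a \<otimes>\<^bsub>G\<^esub> b),
      (a \<otimes>\<^bsub>G\<^esub> b, inv\<^bsub>G\<^esub> b)})"

definition T_one :: "('a, 'm) monoid_scheme \<Rightarrow> ('a \<times> 'a) set \<Rightarrow> ('a \<times> 'a) set" where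
  "T_one G T = {(x, y) \<in> T. x \<noteq> \<one>\<^bsub>G\<^esub> \<and> y \<noteq> \<one>\<^bsub>G\<^esub> \<and> x \<noteq> inv\<^bsub>G\<^esub> y}"

definition T_zero :: "('a, 'm) monoid_scheme \<Rightarrow> ('a \<times> 'a) set \<Rightarrow> 'a set" where
  "T_zero G T = {x \<in> carrier G - {\<one>\<^bsub>G\<^esub>}. orbit_C G (x, inv\<^bsub>G\<^esub> x) \<inter> T \<noteq> {}}"

definition sigma_zero ::
  "('k, 'n) ring_scheme \<Rightarrow> ('a, 'm) monoid_scheme \<Rightarrow> ('a \<times> 'a) set \<Rightarrow> 'a \<times> 'a \<Rightarrow> 'k" where
  "sigma_zero K G T = (\<lambda>(x, y).
     if {x, y, x \<otimes>\<^bsub>G\<^esub> y} \<inter> T_zero G T \<noteq> {} then \<zero>\<^bsub>K\<^esub> else \<one>\<^bsub>K\<^esub>)"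

definition sigma_one ::
  "('k, 'n) ring_scheme \<Rightarrow> ('a, 'm) monoid_scheme \<Rightarrow> ('a \<times> 'a) set \<Rightarrow> 'a \<times> 'a \<Rightarrow> 'k" where
  "sigma_one K G T = (\<lambda>(x, y).
     if orbit_C G (x, y) \<inter> T_one G T \<noteq> {} then \<zero>\<^bsub>K\<^esub> else \<one>\<^bsub>K\<^esub>)"

definition generated_factor_set ::
  "('k, 'n) ring_scheme \<Rightarrow> ('a, 'm) monoid_scheme \<Rightarrow> ('a \<times> 'a) set \<Rightarrow> 'a \<times> 'a \<Rightarrow> 'k" where
  "generated_factor_set K G T = (\<lambda>p. sigma_zero K G T p \<otimes>\<^bsub>K\<^esub> sigma_one K G T p)"

definition prohibitions_I ::
  "('k, 'n) ring_scheme \<Rightarrow> ('a, 'm) monoid_scheme \<Rightarrow> ('a \<times> 'a \<Rightarrow> 'k) \<Rightarrow> 'a set set" where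
  "prohibitions_I K G \<sigma> =
     {{h, h \<otimes>\<^bsub>G\<^esub> g, h \<otimes>\<^bsub>G\<^esub> g \<otimes>\<^bsub>G\<^esub> s} | h g s.
        h \<in> carrier G \<and> g \<in> carrier G \<and> s \<in> carrier G \<and> \<sigma> (g, s) = \<zero>\<^bsub>K\<^esub>}"

definition prohibitions_II ::
  "('k, 'n) ring_scheme \<Rightarrow> ('a, 'm) monoid_scheme \<Rightarrow> ('a \<times> 'a \<Rightarrow> 'k) \<Rightarrow> 'a set set" where
  "prohibitions_II K G \<sigma> =
     {{h, h \<otimes>\<^bsub>G\<^esub> g, h \<otimes>\<^bsub>G\<^esub> g \<otimes>\<^bsub>G\<^esub> s, h \<otimes>\<^bsub>G\<^esub> g \<otimes>\<^bsub>G\<^esub> s \<otimes>\<^bsub>G\<^esub> t} | h g s t.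
        h \<in> carrier G \<and> g \<in> carrier G \<and> s \<in> carrier G \<and> t \<in> carrier G \<and>
        \<sigma> (g, s \<otimes>\<^bsub>G\<^esub> t) \<otimes>\<^bsub>K\<^esub> \<sigma> (s, t) \<noteq> \<sigma> (g, s) \<otimes>\<^bsub>K\<^esub> \<sigma> (g \<otimes>\<^bsub>G\<^esub> s, t)}"

definition prohibitions ::
  "('k, 'n) ring_scheme \<Rightarrow> ('a, 'm) monoid_scheme \<Rightarrow> ('a \<times> 'a \<Rightarrow> 'k) \<Rightarrow> 'a set set" where
  "prohibitions K G \<sigma> = prohibitions_I K G \<sigma> \<union> prohibitions_II K G \<sigma>"

definition Omega :: "('a, 'm) monoid_scheme \<Rightarrow> 'a set set" where
  "Omega G = {\<xi>. \<xi> \<subseteq> carrier G \<and> \<one>\<^bsub>G\<^esub> \<in> \<xi>}"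

text \<open>A set in \<open>Omega G\<close> is identified with its indicator function on \<open>G \<setminus> {1}\<close>; the topology is
  the product topology of discrete two-point spaces, transported along this identification.\<close>

definition Omega_topology :: "('a, 'm) monoid_scheme \<Rightarrow> 'a set topology" where
  "Omega_topology G =
     pullback_topology (Omega G)
       (\<lambda>\<xi>. \<lambda>g\<in>carrier G - {\<one>\<^bsub>G\<^esub>}. g \<in> \<xi>)
       (product_topology (\<lambda>_. discrete_topology (UNIV :: bool set)) (carrier G - {\<one>\<^bsub>G\<^esub>}))"

definition Omega_sigma ::
  "('k, 'n) ring_scheme \<Rightarrow> ('a, 'm) monoid_scheme \<Rightarrow> ('a \<times> 'a \<Rightarrow> 'k) \<Rightarrow> 'a set set" where
  "Omega_sigma K G \<sigma> = {\<xi> \<in> Omega G. \<forall>V \<in> prohibitions K G \<sigma>. \<not> V \<subseteq> \<xi>}"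

definition Omega_sigma_topology ::
  "('k, 'n) ring_scheme \<Rightarrow> ('a, 'm) monoid_scheme \<Rightarrow> ('a \<times> 'a \<Rightarrow> 'k) \<Rightarrow> 'a set topology" where
  "Omega_sigma_topology K G \<sigma> = subtopology (Omega_topology G) (Omega_sigma K G \<sigma>)"

definition spectral_domain ::
  "('k, 'n) ring_scheme \<Rightarrow> ('a, 'm) monoid_scheme \<Rightarrow> ('a \<times> 'a \<Rightarrow> 'k) \<Rightarrow> 'a \<Rightarrow> 'a set set" where
  "spectral_domain K G \<sigma> g = {\<xi> \<in> Omega_sigma K G \<sigma>. g \<in> \<xi>}"

text \<open>The homeomorphism belonging to \<open>g\<close> is \<open>spectral_map G g\<close>, regarded as a map from
  \<open>spectral_domain K G \<sigma> (inv g)\<close> to \<open>spectral_domain K G \<sigma> g\<close>; its values elsewhere are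
  irrelevant.\<close>

definition spectral_map :: "('a, 'm) monoid_scheme \<Rightarrow> 'a \<Rightarrow> 'a set \<Rightarrow> 'a set" where
  "spectral_map G g \<xi> = g <#\<^bsub>G\<^esub> \<xi>"

text \<open>A topological partial action of \<open>G\<close> on the space \<open>X\<close> is presented by its domains \<open>D g\<close> and its
  maps \<open>\<theta> g\<close>, the latter only being relevant on \<open>D (inv g)\<close>.\<close>

definition topologically_free ::
  "('a, 'm) monoid_scheme \<Rightarrow> 'x topology \<Rightarrow> ('a \<Rightarrow> 'x set) \<Rightarrow> ('a \<Rightarrow> 'x \<Rightarrow> 'x) \<Rightarrow> bool" where
  "topologically_free G X D \<theta> \<longleftrightarrow>
     (\<forall>g \<in> carrier G. g \<noteq> \<one>\<^bsub>G\<^esub> \<longrightarrow>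
        X interior_of {x \<in> D (inv\<^bsub>G\<^esub> g). \<theta> g x = x} = {})"

end

theory Submission
  imports Defs
begin

text \<open>For values in \<open>{0, 1}\<close> a failure of the factor set equation forces one of its four
  factors to vanish, so every prohibition of type II contains one of type I, and membership in
  \<open>\<Omega>\<^sub>\<sigma>\<close> becomes a condition on the quotients \<open>u\<inverse>v\<close> of elements of \<open>\<xi>\<close>. Given a nonempty basic open
  set, restrict one of its points to the finitely many prescribed coordinates to get a finite
  \<open>F \<in> \<Omega>\<^sub>\<sigma>\<close>. Adjoining \<open>z\<close> to \<open>F\<close> can only fail if \<open>z \<in> u S\<close> for some \<open>u \<in> F\<close>, where \<open>S\<close> consists of
  the coordinates of \<open>T\<close> and their inverses; as \<open>|T| < |G|\<close>, some fresh \<open>z\<close> is allowed. If \<open>F\<close> is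
  \<open>g\<close>-invariant then \<open>F \<union> {z}\<close> is not, so \<open>g\<close> moves a point of the open set.\<close>

section \<open>Cardinals below an infinite one\<close>

lemma Un_lesspoll_infinite:
  fixes A B :: "'a set" and C :: "'b set"
  assumes "infinite C" "A \<prec> C" "B \<prec> C"
  shows "A \<union> B \<prec> C"
proof -
  \<comment> \<open>Moves to strict comparison of cardinals, where a union of two smaller sets stays
    below an infinite cardinal.\<close>
  have lesspoll_iff: "X \<prec> C \<longleftrightarrow> ordLess2 (card_of X) (card_of C)" for X :: "'a set"
    unfolding lesspoll_def lepoll_def card_of_ordLeq eqpoll_iff_card_of_ordIso
    by (auto simp: ordLeq_iff_ordLess_or_ordIso dest: not_ordLess_ordIso)
  show ?thesis
    unfolding lesspoll_iff
    by (rule card_of_Un_ordLess_infinite[OF assms[unfolded lesspoll_iff]])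
qed

lemma UN_lesspoll_infinite:
  assumes "infinite C" "finite I" "\<And>i. i \<in> I \<Longrightarrow> A i \<prec> C"
  shows "(\<Union>i\<in>I. A i) \<prec> C"
  using assms(2,3)
proof (induction I rule: finite_induct)
  case empty
  show ?case using assms(1) by (simp add: finite_lesspoll_infinite)
next
  case (insert i I)
  then show ?case by (simp add: Un_lesspoll_infinite[OF assms(1)])
qed

section \<open>Zeros of the generated factor set\<close>

lemma generated_factor_set_values:
  assumes "field K"
  shows "generated_factor_set K G T p = \<zero>\<^bsub>K\<^esub> \<or> generated_factor_set K G T p = \<one>\<^bsub>K\<^esub>"
proof -
  interpret K: field K by fact
  show ?thesis
    by (cases p) (simp add: generated_factor_set_def sigma_zero_def sigma_one_def)
qed

lemma generated_factor_set_eq_zero_iff: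
  assumes "field K"
  shows "generated_factor_set K G T (x, y) = \<zero>\<^bsub>K\<^esub> \<longleftrightarrow>
    {x, y, x \<otimes>\<^bsub>G\<^esub> y} \<inter> T_zero G T \<noteq> {} \<or> orbit_C G (x, y) \<inter> T_one G T \<noteq> {}"
proof -
  interpret K: field K by fact
  show ?thesis
    by (simp add: generated_factor_set_def sigma_zero_def sigma_one_def)
qed

section \<open>Membership in \<open>Omega_sigma\<close> through quotients\<close>

context group
begin

lemma quotient_mult:
  assumes "u \<in> carrier G" "v \<in> carrier G" "w \<in> carrier G"
  shows "inv u \<otimes> v \<otimes> (inv v \<otimes> w) = inv u \<otimes> w"
proof -
  have "v \<otimes> (inv v \<otimes> w) = w"
    using assms by (simp add: m_assoc[symmetric])
  then show ?thesis using assms by (simp add: m_assoc)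
qed

text \<open>The six pairs are \<open>(inv p \<otimes> q, inv q \<otimes> r)\<close> for the six
  orderings \<open>(p, q, r)\<close> of \<open>u, v, w\<close>, so whether the orbit meets a given
  set does not depend on the order of the three points.\<close>

lemma orbit_C_quotients:
  assumes "u \<in> carrier G" "v \<in> carrier G" "w \<in> carrier G"
  shows "orbit_C G (inv u \<otimes> v, inv v \<otimes> w) =
    {(inv u \<otimes> v, inv v \<otimes> w), (inv w \<otimes> u, inv u \<otimes> v), (inv v \<otimes> w, inv w \<otimes> u),
     (inv w \<otimes> v, inv v \<otimes> u), (inv v \<otimes> u, inv u \<otimes> w), (inv u \<otimes> w, inv w \<otimes> v)}"
  using assms by (simp add: orbit_C_def inv_mult_group quotient_mult)

lemma prohibition_II_contains_I:
  assumes "field K" "V \<in> prohibitions_II K G (generated_factor_set K G T)"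
  shows "\<exists>W \<in> prohibitions_I K G (generated_factor_set K G T). W \<subseteq> V"
proof -
  interpret K: field K by fact
  let ?\<sigma> = "generated_factor_set K G T"
  obtain h g s t where c: "h \<in> carrier G" "g \<in> carrier G" "s \<in> carrier G" "t \<in> carrier G"
    and V: "V = {h, h \<otimes> g, h \<otimes> g \<otimes> s, h \<otimes> g \<otimes> s \<otimes> t}"
    and ne: "?\<sigma> (g, s \<otimes> t) \<otimes>\<^bsub>K\<^esub> ?\<sigma> (s, t) \<noteq> ?\<sigma> (g, s) \<otimes>\<^bsub>K\<^esub> ?\<sigma> (g \<otimes> s, t)"
    using assms(2) unfolding prohibitions_II_def by blast
  have I: "{h', h' \<otimes> x, h' \<otimes> x \<otimes> y} \<in> prohibitions_I K G ?\<sigma>"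
    if "h' \<in> carrier G" "x \<in> carrier G" "y \<in> carrier G" "?\<sigma> (x, y) = \<zero>\<^bsub>K\<^esub>" for h' x y
    using that unfolding prohibitions_I_def by blast
  \<comment> \<open>If all four factors were one, both sides would agree. A vanishing factor
    prohibits the triple left after dropping one of the four points:
    \<open>h \<otimes> g \<otimes> s\<close>, \<open>h\<close>, the last one,
    \<open>h \<otimes> g\<close>, in the order of the cases.\<close>
  consider "?\<sigma> (g, s \<otimes> t) = \<zero>\<^bsub>K\<^esub>" | "?\<sigma> (s, t) = \<zero>\<^bsub>K\<^esub>" | "?\<sigma> (g, s) = \<zero>\<^bsub>K\<^esub>"
    | "?\<sigma> (g \<otimes> s, t) = \<zero>\<^bsub>K\<^esub>"
    using ne generated_factor_set_values[OF assms(1)] by metis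
  then show ?thesis
  proof cases
    case 1
    show ?thesis
      by (rule bexI[OF _ I[of h g "s \<otimes> t"]]) (use c 1 in \<open>auto simp: V m_assoc\<close>)
  next
    case 2
    show ?thesis
      by (rule bexI[OF _ I[of "h \<otimes> g" s t]]) (use c 2 in \<open>auto simp: V\<close>)
  next
    case 3
    show ?thesis
      by (rule bexI[OF _ I[of h g s]]) (use c 3 in \<open>auto simp: V\<close>)
  next
    case 4
    show ?thesis
      by (rule bexI[OF _ I[of h "g \<otimes> s" t]]) (use c 4 in \<open>auto simp: V m_assoc\<close>)
  qed
qed

text \<open>A type I prohibition is a set \<open>{u, v, w}\<close> with the factor set vanishing at
  \<open>(inv u \<otimes> v, inv v \<otimes> w)\<close>. As triples run through \<open>\<xi>\<close>
  in every order, the orbit in \<open>sigma_one\<close> may be replaced by its first pair, and the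
  three elements tested in \<open>sigma_zero\<close> by a single quotient.\<close>

lemma Omega_sigma_iff:
  assumes "field K"
  shows "\<xi> \<in> Omega_sigma K G (generated_factor_set K G T) \<longleftrightarrow>
    \<xi> \<in> Omega G \<and> (\<forall>u\<in>\<xi>. \<forall>v\<in>\<xi>. inv u \<otimes> v \<notin> T_zero G T) \<and>
    (\<forall>u\<in>\<xi>. \<forall>v\<in>\<xi>. \<forall>w\<in>\<xi>. (inv u \<otimes> v, inv v \<otimes> w) \<notin> T_one G T)"
    (is "?L \<longleftrightarrow> ?R")
proof
  let ?\<sigma> = "generated_factor_set K G T"
  assume L: ?L
  then have O: "\<xi> \<in> Omega G" and c: "\<xi> \<subseteq> carrier G"
    by (auto simp: Omega_sigma_def Omega_def)
  have allowed: "?\<sigma> (inv u \<otimes> v, inv v \<otimes> w) \<noteq> \<zero>\<^bsub>K\<^esub>"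
    if "u \<in> \<xi>" "v \<in> \<xi>" "w \<in> \<xi>" for u v w
  proof
    assume 0: "?\<sigma> (inv u \<otimes> v, inv v \<otimes> w) = \<zero>\<^bsub>K\<^esub>"
    have uvw: "u \<in> carrier G" "v \<in> carrier G" "w \<in> carrier G" using that c by auto
    then have eq: "u \<otimes> (inv u \<otimes> v) = v" "v \<otimes> (inv v \<otimes> w) = w"
      by (simp_all add: inv_solve_left m_assoc[symmetric])
    have "{u, u \<otimes> (inv u \<otimes> v), u \<otimes> (inv u \<otimes> v) \<otimes> (inv v \<otimes> w)} \<in> prohibitions_I K G ?\<sigma>"
      unfolding prohibitions_I_def using 0 uvw by blast
    then have "{u, v, w} \<in> prohibitions K G ?\<sigma>"
      by (simp add: eq prohibitions_def)
    then show False using L that by (auto simp: Omega_sigma_def)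
  qed
  show ?R
  proof (intro conjI ballI O)
    fix u v assume uv: "u \<in> \<xi>" "v \<in> \<xi>"
    \<comment> \<open>The degenerate triple \<open>u, v, v\<close> isolates the quotient of a
      pair.\<close>
    show "inv u \<otimes> v \<notin> T_zero G T"
      using allowed[OF uv uv(2)] by (auto simp: generated_factor_set_eq_zero_iff[OF assms])
  next
    fix u v w assume uvw: "u \<in> \<xi>" "v \<in> \<xi>" "w \<in> \<xi>"
    then have "u \<in> carrier G" "v \<in> carrier G" "w \<in> carrier G" using c by auto
    then show "(inv u \<otimes> v, inv v \<otimes> w) \<notin> T_one G T"
      using allowed[OF uvw]
      by (auto simp: generated_factor_set_eq_zero_iff[OF assms] orbit_C_quotients)
  qed
next
  let ?\<sigma> = "generated_factor_set K G T"
  assume R: ?R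
  then have c: "\<xi> \<subseteq> carrier G" by (auto simp: Omega_def)
  have I: "\<not> V \<subseteq> \<xi>" if V: "V \<in> prohibitions_I K G ?\<sigma>" for V
  proof
    assume sub: "V \<subseteq> \<xi>"
    obtain h g s where cc: "h \<in> carrier G" "g \<in> carrier G" "s \<in> carrier G"
      and Veq: "V = {h, h \<otimes> g, h \<otimes> g \<otimes> s}" and 0: "?\<sigma> (g, s) = \<zero>\<^bsub>K\<^esub>"
      using V unfolding prohibitions_I_def by blast
    define v w where "v = h \<otimes> g" and "w = h \<otimes> g \<otimes> s"
    have vw: "h \<in> \<xi>" "v \<in> \<xi>" "w \<in> \<xi>" using sub Veq by (auto simp: v_def w_def)
    have g: "g = inv h \<otimes> v" and s: "s = inv v \<otimes> w"
      using cc by (simp_all add: v_def w_def inv_solve_left inv_solve_left')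
    have "h \<in> carrier G" "v \<in> carrier G" "w \<in> carrier G" using vw c by auto
    with 0 have "{inv h \<otimes> v, inv v \<otimes> w, inv h \<otimes> w} \<inter> T_zero G T \<noteq> {} \<or>
      orbit_C G (inv h \<otimes> v, inv v \<otimes> w) \<inter> T_one G T \<noteq> {}"
      unfolding g s generated_factor_set_eq_zero_iff[OF assms] by (simp add: quotient_mult)
    with R vw \<open>h \<in> carrier G\<close> \<open>v \<in> carrier G\<close> \<open>w \<in> carrier G\<close> show False
      by (auto simp: orbit_C_quotients)
  qed
  have "\<not> V \<subseteq> \<xi>" if "V \<in> prohibitions_II K G ?\<sigma>" for V
    using prohibition_II_contains_I[OF assms that] I by blast
  with R I show ?L by (auto simp: Omega_sigma_def prohibitions_def)
qed

text \<open>Removing elements cannot create a prohibition; this permits passing to finite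
  sets.\<close>

lemma Omega_sigma_subset:
  assumes "\<xi> \<in> Omega_sigma K G \<sigma>" "\<eta> \<subseteq> \<xi>" "\<one> \<in> \<eta>"
  shows "\<eta> \<in> Omega_sigma K G \<sigma>"
  using assms unfolding Omega_sigma_def Omega_def by blast

section \<open>Adjoining a fresh element to a finite set\<close>

lemma Omega_sigma_extend_fresh:
  assumes "field K" "infinite (carrier G)" "T \<subseteq> carrier G \<times> carrier G" "T \<prec> carrier G"
    and \<xi>: "\<xi> \<in> Omega_sigma K G (generated_factor_set K G T)" "finite \<xi>" and "finite F"
  obtains z where "z \<in> carrier G" "z \<notin> \<xi>" "z \<notin> F"
    "insert z \<xi> \<in> Omega_sigma K G (generated_factor_set K G T)"
proof -
  \<comment> \<open>Closed under inverses, so that keeping \<open>inv u \<otimes> z\<close> out of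
    \<open>S\<close> also keeps \<open>inv z \<otimes> u\<close> out.\<close>
  define S where "S = fst ` T \<union> snd ` T \<union> (\<lambda>p. inv (fst p)) ` T \<union> (\<lambda>p. inv (snd p)) ` T"
  \<comment> \<open>\<open>F\<close> and \<open>\<xi>\<close> are avoided for freshness, the
    translates of \<open>S\<close> to keep the new quotients out of \<open>S\<close>.\<close>
  define B where "B = F \<union> \<xi> \<union> (\<Union>u\<in>\<xi>. (\<lambda>s. u \<otimes> s) ` S)"
  note R = \<xi>(1)[unfolded Omega_sigma_iff[OF assms(1)]]
  have c: "\<xi> \<subseteq> carrier G" "\<one> \<in> \<xi>" using R by (auto simp: Omega_def)
  note image_T = lesspoll_trans1[OF image_lepoll assms(4)]
  have "S \<prec> carrier G"
    unfolding S_def by (intro Un_lesspoll_infinite assms(2) image_T)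
  then have "(\<Union>u\<in>\<xi>. (\<lambda>s. u \<otimes> s) ` S) \<prec> carrier G"
    by (blast intro: UN_lesspoll_infinite[OF assms(2) \<xi>(2)] lesspoll_trans1[OF image_lepoll])
  then have "B \<prec> carrier G"
    unfolding B_def using assms(2,7) \<xi>(2)
    by (simp add: Un_lesspoll_infinite finite_lesspoll_infinite)
  then have "\<not> carrier G \<subseteq> B"
    using lesspoll_trans2 subset_imp_lepoll lesspoll_not_refl by metis
  then obtain z where z: "z \<in> carrier G" "z \<notin> B"
    by blast
  have S_I: "x \<in> S" "y \<in> S" "inv x \<in> S" "inv y \<in> S" if "(x, y) \<in> T" for x y
    using imageI[OF that, of fst] imageI[OF that, of snd] imageI[OF that, of "\<lambda>p. inv (fst p)"]
      imageI[OF that, of "\<lambda>p. inv (snd p)"] unfolding S_def by simp_all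
  have inv_S: "inv s \<in> S" if s: "s \<in> S" for s
  proof -
    obtain x y where xy: "(x, y) \<in> T" "s = x \<or> s = y \<or> s = inv x \<or> s = inv y"
      using s unfolding S_def by auto
    moreover have "x \<in> carrier G" "y \<in> carrier G" using xy(1) assms(3) by auto
    ultimately show ?thesis using S_I[OF xy(1)] by auto
  qed
  have T1: "x \<in> S" "y \<in> S" "x \<noteq> \<one>" "y \<noteq> \<one>" if "(x, y) \<in> T_one G T" for x y
    using that S_I[of x y] by (simp_all add: T_one_def)
  have T0: "x \<in> S" "x \<noteq> \<one>" if "x \<in> T_zero G T" for x
  proof -
    have x: "x \<in> carrier G" "x \<noteq> \<one>" "orbit_C G (x, inv x) \<inter> T \<noteq> {}"
      using that by (auto simp: T_zero_def)
    \<comment> \<open>The orbit of \<open>(x, inv x)\<close> collapses to these three pairs, each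
      having \<open>x\<close> or \<open>inv x\<close> as a coordinate.\<close>
    then have "(x, inv x) \<in> T \<or> (\<one>, x) \<in> T \<or> (inv x, \<one>) \<in> T"
      by (auto simp: orbit_C_def)
    then show "x \<in> S" "x \<noteq> \<one>"
      using x S_I[of x "inv x"] S_I[of \<one> x] S_I[of "inv x" \<one>] by auto
  qed
  have uz: "inv u \<otimes> z \<notin> S" if "u \<in> \<xi>" for u
  proof
    assume "inv u \<otimes> z \<in> S"
    moreover have "z = u \<otimes> (inv u \<otimes> z)"
      using z(1) that c by (simp add: subset_iff m_assoc[symmetric])
    ultimately show False using z(2) that unfolding B_def by blast
  qed
  have zu: "inv z \<otimes> u \<notin> S" if "u \<in> \<xi>" for u
    using inv_S[of "inv z \<otimes> u"] uz[OF that] z(1) that c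
    by (auto simp: subset_iff inv_mult_group)
  have zz: "inv z \<otimes> z = \<one>" using z(1) by simp
  have "insert z \<xi> \<in> Omega_sigma K G (generated_factor_set K G T)"
    unfolding Omega_sigma_iff[OF assms(1)]
  proof (intro conjI ballI)
    show "insert z \<xi> \<in> Omega G" using c z(1) by (auto simp: Omega_def)
  next
    fix u v assume "u \<in> insert z \<xi>" "v \<in> insert z \<xi>"
    then show "inv u \<otimes> v \<notin> T_zero G T"
      using R T0[of "inv u \<otimes> v"] uz zu zz by blast
  next
    \<comment> \<open>In a triple containing \<open>z\<close>, one of the two quotients is
      \<open>\<one>\<close> or compares \<open>z\<close> with a point of \<open>\<xi>\<close> and so
      lies outside \<open>S\<close>; neither can be a coordinate of a pair in
      \<open>T_one G T\<close>.\<close>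
    fix u v w assume "u \<in> insert z \<xi>" "v \<in> insert z \<xi>" "w \<in> insert z \<xi>"
    then show "(inv u \<otimes> v, inv v \<otimes> w) \<notin> T_one G T"
      using R T1[of "inv u \<otimes> v" "inv v \<otimes> w"] uz zu zz by blast
  qed
  with z that show thesis unfolding B_def by blast
qed

end

section \<open>Neighbourhoods given by finitely many coordinates\<close>

lemma Omega_topology_openE:
  assumes "openin (Omega_topology G) U" "\<xi> \<in> U"
  obtains F where "finite F"
    "\<And>\<eta>. \<eta> \<in> Omega G \<Longrightarrow> (\<And>x. x \<in> F \<Longrightarrow> x \<in> \<eta> \<longleftrightarrow> x \<in> \<xi>) \<Longrightarrow> \<eta> \<in> U"
proof -
  let ?I = "carrier G - {\<one>\<^bsub>G\<^esub>}"
  let ?f = "\<lambda>\<eta>. \<lambda>g\<in>?I. g \<in> \<eta>"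
  obtain W where W: "openin (product_topology (\<lambda>_. discrete_topology (UNIV :: bool set)) ?I) W"
    and U: "U = ?f -` W \<inter> Omega G"
    using assms(1) unfolding Omega_topology_def openin_pullback_topology by blast
  have "?f \<xi> \<in> W" using assms(2) U by auto
  then obtain X where X: "?f \<xi> \<in> (\<Pi>\<^sub>E i\<in>?I. X i)" "(\<Pi>\<^sub>E i\<in>?I. X i) \<subseteq> W"
    and fin: "finite {i. X i \<noteq> UNIV}"
    using product_topology_open_contains_basis[OF W] by force
  show thesis
  proof (rule that[OF fin])
    fix \<eta> assume \<eta>: "\<eta> \<in> Omega G"
      and eq: "\<And>x. x \<in> {i. X i \<noteq> UNIV} \<Longrightarrow> x \<in> \<eta> \<longleftrightarrow> x \<in> \<xi>"
    \<comment> \<open>An unrestricted coordinate allows both values; at any other one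
      \<open>\<eta>\<close> agrees with \<open>\<xi>\<close>.\<close>
    have "(i \<in> \<eta>) \<in> X i" if "i \<in> ?I" for i
      using X(1) that eq[of i] by (cases "X i = UNIV") (auto simp: PiE_iff)
    then have "?f \<eta> \<in> (\<Pi>\<^sub>E i\<in>?I. X i)" by (auto simp: PiE_iff)
    then have "?f \<eta> \<in> W" using X(2) by (rule subsetD[rotated])
    then show "\<eta> \<in> U" using U \<eta> by blast
  qed
qed

section \<open>Moving a point of a nonempty open set\<close>

theorem corollary9p13:
  fixes K :: "('k, 'n) ring_scheme"
    and G :: "('a, 'm) monoid_scheme"
    and T :: "('a \<times> 'a) set"
    and \<sigma> :: "'a \<times> 'a \<Rightarrow> 'k"
  assumes "field K"
    and "group G"
    and "infinite (carrier G)"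
    and "\<exists>x \<in> carrier G. x \<noteq> \<one>\<^bsub>G\<^esub> \<and> (\<exists>n::nat. n > 0 \<and> x [^]\<^bsub>G\<^esub> n = \<one>\<^bsub>G\<^esub>)"
    and "T \<subseteq> carrier G \<times> carrier G"
    and "(\<one>\<^bsub>G\<^esub>, \<one>\<^bsub>G\<^esub>) \<notin> T"
    and "\<forall>x y. (x, y) \<in> T \<longrightarrow> (inv\<^bsub>G\<^esub> y, inv\<^bsub>G\<^esub> x) \<in> T"
    and "\<sigma> = generated_factor_set K G T"
    and "T \<prec> carrier G"
  shows "topologically_free G (Omega_sigma_topology K G \<sigma>)
           (spectral_domain K G \<sigma>) (spectral_map G)"
proof -
  interpret group G by fact
  note \<sigma> = assms(8)
  show ?thesis
    unfolding topologically_free_def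
  proof (intro ballI impI)
    fix g assume g: "g \<in> carrier G" "g \<noteq> \<one>\<^bsub>G\<^esub>"
    let ?Fix = "{x \<in> spectral_domain K G \<sigma> (inv\<^bsub>G\<^esub> g). spectral_map G g x = x}"
    show "Omega_sigma_topology K G \<sigma> interior_of ?Fix = {}"
    proof (rule ccontr)
      assume "Omega_sigma_topology K G \<sigma> interior_of ?Fix \<noteq> {}"
      then obtain \<xi> U where U: "openin (Omega_topology G) U" "\<xi> \<in> U" "\<xi> \<in> Omega_sigma K G \<sigma>"
        "U \<inter> Omega_sigma K G \<sigma> \<subseteq> ?Fix"
        unfolding interior_of_def Omega_sigma_topology_def openin_subtopology by blast
      obtain F where F: "finite F"
        "\<And>\<eta>. \<eta> \<in> Omega G \<Longrightarrow> (\<And>x. x \<in> F \<Longrightarrow> x \<in> \<eta> \<longleftrightarrow> x \<in> \<xi>) \<Longrightarrow> \<eta> \<in> U"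
        using Omega_topology_openE[OF U(1,2)] by blast
      have fixed: "spectral_map G g \<eta> = \<eta>"
        if "\<eta> \<in> Omega_sigma K G \<sigma>" "\<And>x. x \<in> F \<Longrightarrow> x \<in> \<eta> \<longleftrightarrow> x \<in> \<xi>" for \<eta>
        using F(2)[of \<eta>] U(4) that by (auto simp: Omega_sigma_def)
      have \<xi>: "\<one>\<^bsub>G\<^esub> \<in> \<xi>" "\<xi> \<subseteq> carrier G" using U(3) by (auto simp: Omega_sigma_def Omega_def)
      \<comment> \<open>The smallest set in \<open>Omega G\<close> agreeing with
        \<open>\<xi>\<close> on \<open>F\<close>; \<open>\<one>\<close> is inserted because
        \<open>F\<close> may omit it.\<close>
      define \<eta> where "\<eta> = insert \<one>\<^bsub>G\<^esub> (\<xi> \<inter> F)"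
      have \<eta>: "\<eta> \<in> Omega_sigma K G \<sigma>" "finite \<eta>" "\<eta> \<subseteq> carrier G"
        using Omega_sigma_subset[OF U(3), of \<eta>] \<xi> F(1) by (auto simp: \<eta>_def)
      obtain z where z: "z \<in> carrier G" "z \<notin> \<eta>" "z \<notin> F" "insert z \<eta> \<in> Omega_sigma K G \<sigma>"
        using Omega_sigma_extend_fresh[OF assms(1,3,5,9) \<eta>(1)[unfolded \<sigma>] \<eta>(2) F(1)] \<sigma> by blast
      have "spectral_map G g \<eta> = \<eta>"
        by (rule fixed[OF \<eta>(1)]) (use \<xi> in \<open>auto simp: \<eta>_def\<close>)
      \<comment> \<open>As \<open>z\<close> is outside \<open>F\<close>, adjoining it changes no
        prescribed coordinate.\<close>
      moreover have "spectral_map G g (insert z \<eta>) = insert z \<eta>"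
        by (rule fixed[OF z(4)]) (use \<xi> z in \<open>auto simp: \<eta>_def\<close>)
      ultimately have img: "(\<lambda>x. g \<otimes>\<^bsub>G\<^esub> x) ` \<eta> = \<eta>"
        "(\<lambda>x. g \<otimes>\<^bsub>G\<^esub> x) ` insert z \<eta> = insert z \<eta>"
        unfolding spectral_map_def l_coset_def by auto
      \<comment> \<open>Translation by \<open>g\<close> has no fixed points, so \<open>z\<close>
        would be sent into \<open>\<eta>\<close>. Since \<open>\<eta>\<close> is already the image
        of \<open>\<eta>\<close>, injectivity forbids this.\<close>
      have "g \<otimes>\<^bsub>G\<^esub> z \<noteq> z" using g z(1) by (simp add: r_cancel_one)
      with img(2) have "g \<otimes>\<^bsub>G\<^esub> z \<in> \<eta>" by blast
      then obtain y where "y \<in> \<eta>" "g \<otimes>\<^bsub>G\<^esub> z = g \<otimes>\<^bsub>G\<^esub> y" using img(1) by blast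
      with z(1,2) g(1) \<eta>(3) show False by auto
    qed
  qed
qed

end
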